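(* Let $(c(n))_{n\ge 0}=(C_0,-C_1,-C_1,C_2,C_2,-C_3,-C_3,\dots)=(1,-1,-1,2,2,-5,-5,14,14,\dots)$, i.e. $c(0)=1$ and $c(2m-1)=c(2m)=(-1)^m C_m$ for $m\ge 1$, where $C_m$ are the Catalan numbers. Then for all integers $n\ge 0$ $$\det\bigl(c(i+j)\bigr)_{i,j=0}^{n-1}=(-1)^{\binom n2}F_{n+1}$$ and $$\det\bigl(c(i+j+1)\bigr)_{i,j=0}^{n-1}=(-1)^{\binom{n+1}2}F_{2\lfloor (n+2)/2\rfloor}.$$
   Context: $C_n=\frac{1}{n+1}\binom{2n}{n}$ is the $n$-th Catalan number. $F_n$ is the Fibonacci sequence $F_0=0$, $F_1=1$, $F_n=F_{n-1}+F_{n-2}$. The determinant of the empty ($0\times 0$) matrix is $1$. *)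

theory Defs
  imports "HOL-Number_Theory.Fib" "Jordan_Normal_Form.Determinant"
begin

(* The division is exact, see Suc_times_catalan. *)
definition catalan :: "nat \<Rightarrow> nat" where
  "catalan n = ((2 * n) choose n) div (n + 1)"

lemma Suc_times_catalan: "(n + 1) * catalan n = (2 * n) choose n"
proof -
  have "Suc n * ((2 * n) choose Suc n) = n * ((2 * n) choose n)"
    using binomial_absorb_comp[of "2 * n" n] binomial_absorption[of n "2 * n"]
    by (simp only: mult_2 diff_add_inverse)
  then have "(n + 1) * ((2 * n) choose n) = (n + 1) * ((2 * n) choose Suc n) + ((2 * n) choose n)"
    by simp
  then have "n + 1 dvd (2 * n) choose n"
    by (metis dvd_add_right_iff dvd_triv_left)
  then show ?thesis
    unfolding catalan_def by (rule dvd_mult_div_cancel)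
qed

lemma of_nat_catalan:
  "(of_nat (catalan n) :: 'a :: field_char_0) = 1 / of_nat (n + 1) * of_nat ((2 * n) choose n)"
proof -
  have "(of_nat (n + 1) :: 'a) * of_nat (catalan n) = of_nat ((2 * n) choose n)"
    by (metis Suc_times_catalan of_nat_mult)
  moreover have "(of_nat (n + 1) :: 'a) \<noteq> 0"
    using of_nat_neq_0[of n, where ?'a = 'a] by simp
  ultimately show ?thesis
    by (simp add: field_simps)
qed

(* The index (k + 1) div 2 equals m exactly for k = 2 * m - 1 and k = 2 * m;
   see cseq_0, cseq_odd and cseq_even. *)
definition cseq :: "nat \<Rightarrow> int" where
  "cseq k = (- 1) ^ ((k + 1) div 2) * int (catalan ((k + 1) div 2))"

lemma cseq_0: "cseq 0 = 1"
  by (simp add: cseq_def catalan_def)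

lemma cseq_odd: "m \<ge> 1 \<Longrightarrow> cseq (2 * m - 1) = (- 1) ^ m * int (catalan m)"
  by (simp add: cseq_def)

lemma cseq_even: "cseq (2 * m) = (- 1) ^ m * int (catalan m)"
  by (simp add: cseq_def)

end

(* The sequence is c(k) = mu(k) + mu(k + 1), where mu = (1, 0, -1, 0, 2, 0, -5, ...) is the moment
   sequence whose monic orthogonal polynomials are the Fibonacci polynomials P_k, with
   P_(k+2) = x P_(k+1) + P_k. Hence the two Hankel determinants belong to the moment functional of mu
   with weights 1 + x and x (1 + x). Orthogonal polynomials for these weights are explicit:
   for 1 + x,
     p_k = F_1 P_0 + ... + F_(k+1) P_k,   (1 + x) p_k = F_(k+2) P_k + F_(k+1) P_(k+1);
   for x (1 + x), with Q_k = P_(k+1) / x for even k,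
     q_k = Q_k (k even),   q_k = p_k - F_(k+2) Q_(k-1) (k odd).
   The quotient of consecutive Hankel determinants is read off from the leading coefficient of the
   orthogonal polynomial and its moment against x^k. *)
theory Submission
  imports Defs
begin

section \<open>Linear functionals given by their moments\<close>

definition moment :: "(nat \<Rightarrow> 'a::comm_ring_1) \<Rightarrow> 'a poly \<Rightarrow> 'a" where
  "moment c p = (\<Sum>j\<le>degree p. coeff p j * c j)"

lemma moment_altdef:
  assumes "degree p \<le> n"
  shows "moment c p = (\<Sum>j\<le>n. coeff p j * c j)"
  unfolding moment_def
  by (rule sum.mono_neutral_left) (use assms in \<open>auto simp: coeff_eq_0\<close>)

lemma moment_add: "moment c (p + q) = moment c p + moment c q"
proof -
  define n where "n = max (degree p) (degree q)"
  have "degree (p + q) \<le> n" "degree p \<le> n" "degree q \<le> n"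
    using degree_add_le_max[of p q] by (auto simp: n_def)
  then show ?thesis
    by (simp add: moment_altdef[of _ n] sum.distrib algebra_simps)
qed

lemma moment_smult: "moment c (smult a p) = a * moment c p"
  using moment_altdef[of "smult a p" "degree p" c] degree_smult_le[of a p]
  by (simp add: moment_def sum_distrib_left mult.assoc)

lemma moment_diff: "moment c (p - q) = moment c p - moment c q"
  using moment_add[of c p "- q"] moment_smult[of c "- 1" q] by simp

lemma moment_pCons: "moment c (pCons a p) = a * c 0 + moment (\<lambda>k. c (Suc k)) p"
proof -
  have "moment c (pCons a p) = (\<Sum>j\<le>Suc (degree p). coeff (pCons a p) j * c j)"
    by (rule moment_altdef) (rule degree_pCons_le)
  then show ?thesis
    by (simp only: sum.atMost_Suc_shift) (simp add: moment_def)
qed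

lemma moment_add_seq: "moment (\<lambda>k. c k + d k) p = moment c p + moment d p"
  by (simp add: moment_def sum.distrib algebra_simps)

text \<open>Multiplication by x shifts the moment sequence, so the induction generalises
  \<open>c\<close>. The right-hand side is row \<open>i\<close> of the Hankel matrix applied to the
  coefficients of \<open>p\<close>.\<close>

lemma moment_monom_mult:
  "moment c (monom 1 i * p) = (\<Sum>j\<le>degree p. coeff p j * c (i + j))"
proof (induction i arbitrary: c)
  case 0
  then show ?case by (simp add: moment_def)
next
  case (Suc i)
  then show ?case by (simp add: monom_Suc moment_pCons)
qed

section \<open>Hankel determinants from orthogonal polynomials\<close>

text \<open>The Hankel matrix times the upper triangular coefficient matrix of the
  \<open>p k\<close> has the moments of x^i \<open>p k\<close> as entries, and orthogonality makes
  this product lower triangular.\<close>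

lemma det_hankel_orthogonal:
  fixes c :: "nat \<Rightarrow> 'a::idom"
  assumes deg: "\<And>k. degree (p k) \<le> k"
    and orth: "\<And>i k. i < k \<Longrightarrow> moment c (monom 1 i * p k) = 0"
  shows "det (mat n n (\<lambda>(i, j). c (i + j))) * (\<Prod>k<n. coeff (p k) k)
    = (\<Prod>k<n. moment c (monom 1 k * p k))"
proof -
  define H where "H = mat n n (\<lambda>(i, j). c (i + j))"
  define V where "V = mat n n (\<lambda>(j, k). coeff (p k) j)"
  define W where "W = mat n n (\<lambda>(i, k). moment c (monom 1 i * p k))"
  have carr: "H \<in> carrier_mat n n" "V \<in> carrier_mat n n" "W \<in> carrier_mat n n"
    by (simp_all add: H_def V_def W_def)
  have "H * V = W"
  proof (rule eq_matI)
    fix i k assume "i < dim_row W" "k < dim_col W"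
    then have ik: "i < n" "k < n" by (simp_all add: W_def)
    have "(H * V) $$ (i, k) = (\<Sum>j<n. c (i + j) * coeff (p k) j)"
      using ik by (simp add: H_def V_def scalar_prod_def atLeast0LessThan)
    also have "\<dots> = (\<Sum>j\<le>degree (p k). c (i + j) * coeff (p k) j)"
      by (rule sum.mono_neutral_right)
        (use deg[of k] ik in \<open>auto simp: coeff_eq_0\<close>)
    also have "\<dots> = W $$ (i, k)"
      using ik by (simp add: W_def moment_monom_mult mult.commute[of "c _"])
    finally show "(H * V) $$ (i, k) = W $$ (i, k)" .
  qed (simp_all add: H_def V_def W_def)
  moreover have "det V = (\<Prod>k<n. coeff (p k) k)"
  proof -
    have "upper_triangular V"
      unfolding upper_triangular_def V_def
      using deg by (auto intro!: coeff_eq_0 le_less_trans[OF deg])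
    then show ?thesis
      using det_upper_triangular[OF _ carr(2)]
      by (simp add: prod_list_diag_prod V_def atLeast0LessThan)
  qed
  moreover have "det W = (\<Prod>k<n. moment c (monom 1 k * p k))"
    using det_lower_triangular[OF _ carr(3)] orth
    by (simp add: prod_list_diag_prod W_def atLeast0LessThan)
  ultimately show ?thesis
    using det_mult[OF carr(1,2)] by (simp add: H_def)
qed

text \<open>A conjectured value \<open>t\<close> is verified by telescoping: \<open>step\<close> is
  the division-free form of \<open>t (Suc k)\<close> / \<open>t k\<close> = moment / leading
  coefficient, and \<open>lead\<close> permits the final cancellation.\<close>

lemma det_hankel_eqI:
  fixes c :: "nat \<Rightarrow> 'a::idom"
  assumes deg: "\<And>k. degree (p k) \<le> k" and lead: "\<And>k. coeff (p k) k \<noteq> 0"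
    and orth: "\<And>i k. i < k \<Longrightarrow> moment c (monom 1 i * p k) = 0"
    and "t 0 = 1"
    and step: "\<And>k. moment c (monom 1 k * p k) * t k = coeff (p k) k * t (Suc k)"
  shows "det (mat n n (\<lambda>(i, j). c (i + j))) = t n"
proof -
  have "(\<Prod>k<n. moment c (monom 1 k * p k)) = t n * (\<Prod>k<n. coeff (p k) k)"
  proof (induction n)
    case 0
    then show ?case using \<open>t 0 = 1\<close> by simp
  next
    case (Suc n)
    then show ?case using step[of n] by (simp add: mult_ac)
  qed
  moreover have "(\<Prod>k<n. coeff (p k) k) \<noteq> 0"
    using lead by simp
  ultimately show ?thesis
    using det_hankel_orthogonal[of p c n, OF deg orth] by simp
qed

section \<open>Fibonacci polynomials and their moments\<close>

fun fib_poly :: "nat \<Rightarrow> int poly" where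
  "fib_poly 0 = 1"
| "fib_poly (Suc 0) = [:0, 1:]"
| "fib_poly (Suc (Suc n)) = pCons 0 (fib_poly (Suc n)) + fib_poly n"

text \<open>The moment of \<open>fib_poly n\<close> against the \<open>i\<close>-th power. Writing the ballot numbers with
  lower index \<open>(i + n) div 2\<close> makes them vanish for \<open>i < n\<close> without a case distinction.\<close>

definition signed_ballot :: "nat \<Rightarrow> nat \<Rightarrow> int" where
  "signed_ballot i n = (if even (i + n) then (- 1) ^ ((i + n) div 2) *
     (int (i choose ((i + n) div 2)) - int (i choose Suc ((i + n) div 2))) else 0)"

lemma signed_ballot_eq_0: "i < n \<Longrightarrow> signed_ballot i n = 0"
proof -
  assume "i < n"
  then have "even (i + n) \<Longrightarrow> i < (i + n) div 2"
    by presburger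
  then show ?thesis
    by (auto simp: signed_ballot_def binomial_eq_0)
qed

lemma signed_ballot_same: "signed_ballot n n = (- 1) ^ n"
  by (simp add: signed_ballot_def)

text \<open>Pascal's rule; this mirrors P_(n+2) = x P_(n+1) + P_n.\<close>

lemma signed_ballot_rec:
  "signed_ballot i (Suc (Suc n)) = signed_ballot (Suc i) (Suc n) + signed_ballot i n"
  by (simp add: signed_ballot_def algebra_simps)

text \<open>The boundary case, matching P_1 = x P_0. For odd \<open>i\<close> it needs the symmetry
  of the two middle binomial coefficients besides Pascal's rule.\<close>

lemma signed_ballot_Suc_0: "signed_ballot (Suc i) 0 = signed_ballot i (Suc 0)"
proof (cases "even i")
  case False
  then obtain k where k: "i = Suc (2 * k)" by (auto elim!: oddE)
  have "Suc (2 * k) choose k = Suc (2 * k) choose Suc k"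
    using binomial_symmetric[of k "Suc (2 * k)"] by (simp add: Suc_diff_le)
  then show ?thesis
    by (simp add: signed_ballot_def k)
qed (simp add: signed_ballot_def)

lemma catalan_eq_diff: "int (catalan m) = int ((2 * m) choose m) - int ((2 * m) choose Suc m)"
proof -
  have "Suc m * ((2 * m) choose Suc m) = m * ((2 * m) choose m)"
    using binomial_absorb_comp[of "2 * m" m] binomial_absorption[of m "2 * m"]
    by (simp only: mult_2 diff_add_inverse)
  then have "int (Suc m) * int ((2 * m) choose Suc m) = int m * int ((2 * m) choose m)"
    by (metis of_nat_mult)
  moreover have "int (Suc m) * int (catalan m) = int ((2 * m) choose m)"
    using Suc_times_catalan[of m] by (metis Suc_eq_plus1 of_nat_mult)
  ultimately have "int (Suc m) * int (catalan m)
      = int (Suc m) * (int ((2 * m) choose m) - int ((2 * m) choose Suc m))"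
    by (simp add: algebra_simps)
  then show ?thesis by simp
qed

text \<open>Exactly one of \<open>k\<close> and \<open>Suc k\<close> is even; the summand with the
  odd index vanishes and the other is a signed Catalan number by
  \<open>catalan_eq_diff\<close>.\<close>

lemma cseq_eq_signed_ballot: "cseq k = signed_ballot k 0 + signed_ballot (Suc k) 0"
  by (cases "even k")
    (auto elim!: evenE oddE simp: cseq_def signed_ballot_def catalan_eq_diff simp flip: mult_2)

abbreviation L :: "int poly \<Rightarrow> int" where
  "L \<equiv> moment (\<lambda>k. signed_ballot k 0)"

text \<open>Both sides obey the same recurrence in \<open>n\<close> and agree for \<open>n\<close> =
  0 and 1. With \<open>signed_ballot_eq_0\<close> this is the orthogonality of the Fibonacci
  polynomials under \<open>L\<close>.\<close>

lemma L_monom_fib_poly: "L (monom 1 i * fib_poly n) = signed_ballot i n"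
proof (induction n arbitrary: i rule: fib_poly.induct)
  case 1
  then show ?case using moment_monom_mult[of _ i 1] by simp
next
  case 2
  then show ?case
    using moment_monom_mult[of _ i "[:0, 1 :: int:]"] by (simp add: signed_ballot_Suc_0)
next
  case (3 n)
  have "monom 1 i * fib_poly (Suc (Suc n))
      = monom 1 (Suc i) * fib_poly (Suc n) + monom 1 i * fib_poly n"
    by (simp add: monom_Suc algebra_simps)
  then show ?case
    using 3 by (simp only: moment_add signed_ballot_rec)
qed

lemma moment_shift: "moment (\<lambda>k. c (Suc k)) p = moment c (pCons 0 p)"
  by (simp add: moment_pCons)

lemma moment_cseq: "moment cseq p = L ([:1, 1:] * p)"
proof -
  have "moment cseq p = L p + moment (\<lambda>k. signed_ballot (Suc k) 0) p"
    by (simp add: cseq_eq_signed_ballot[abs_def] moment_add_seq)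
  also have "\<dots> = L (p + pCons 0 p)"
    by (simp only: moment_shift[of "\<lambda>k. signed_ballot k 0"] moment_add)
  finally show ?thesis by simp
qed

lemma fib_poly_monic: "degree (fib_poly n) \<le> n \<and> coeff (fib_poly n) n = 1"
proof (induction n rule: fib_poly.induct)
  case (3 n)
  then have "degree (pCons 0 (fib_poly (Suc n))) \<le> Suc (Suc n)"
    by (meson Suc_le_mono degree_pCons_le le_trans)
  moreover have "degree (fib_poly n) < Suc (Suc n)"
    using 3 by simp
  ultimately show ?case
    using 3 by (auto intro!: degree_add_le simp: coeff_eq_0)
qed auto

lemmas degree_fib_poly_le = fib_poly_monic[THEN conjunct1]
lemmas coeff_fib_poly_self = fib_poly_monic[THEN conjunct2]

section \<open>Orthogonal polynomials for the weight 1 + x\<close>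

text \<open>This is the Christoffel-Darboux kernel at -1, the zero of the weight: P_j(-1) = (-1)^j
  F_(j+1), and P_j has squared norm (-1)^j under \<open>L\<close>.\<close>

definition fib_sum_poly :: "nat \<Rightarrow> int poly" where
  "fib_sum_poly k = (\<Sum>j\<le>k. smult (int (fib (Suc j))) (fib_poly j))"

lemma degree_fib_sum_poly_le: "degree (fib_sum_poly k) \<le> k"
  unfolding fib_sum_poly_def
  by (rule degree_sum_le)
    (auto intro: order.trans[OF degree_smult_le] order.trans[OF degree_fib_poly_le])

lemma coeff_fib_sum_poly_self: "coeff (fib_sum_poly k) k = int (fib (Suc k))"
proof -
  have "coeff (fib_sum_poly k) k = (\<Sum>j\<le>k. if j = k then int (fib (Suc j)) else 0)"
    unfolding fib_sum_poly_def coeff_sum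
    by (rule sum.cong)
      (auto simp: coeff_fib_poly_self intro!: coeff_eq_0 le_less_trans[OF degree_fib_poly_le])
  then show ?thesis by simp
qed

text \<open>The sum telescopes: (1 + x) P_(k+1) = P_(k+1) + P_(k+2) - P_k, and its last term, scaled
  by F_(k+2), cancels the P_k from the induction hypothesis.\<close>

lemma fib_sum_poly_mult:
  "[:1, 1:] * fib_sum_poly k
    = smult (int (fib (k + 2))) (fib_poly k) + smult (int (fib (Suc k))) (fib_poly (Suc k))"
proof (induction k)
  case 0
  then show ?case by (simp add: fib_sum_poly_def)
next
  case (Suc k)
  have "[:1, 1:] * fib_sum_poly (Suc k)
      = [:1, 1:] * fib_sum_poly k + smult (int (fib (k + 2))) ([:1, 1:] * fib_poly (Suc k))"
    by (simp add: fib_sum_poly_def algebra_simps)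
  also have "[:1, 1:] * fib_poly (Suc k) = fib_poly (Suc k) + fib_poly (Suc (Suc k)) - fib_poly k"
    by simp
  moreover have "int (fib (Suc k + 2)) = int (fib (k + 2)) + int (fib (Suc k))"
    by simp
  ultimately show ?case
    by (simp only: Suc.IH)
      (simp add: algebra_simps smult_add_left smult_add_right smult_diff_right
        del: fib.simps fib_poly.simps)
qed

lemma cseq_moment_fib_sum_poly:
  "moment cseq (monom 1 i * fib_sum_poly k)
    = int (fib (k + 2)) * signed_ballot i k + int (fib (Suc k)) * signed_ballot i (Suc k)"
proof -
  have "[:1, 1:] * (monom 1 i * fib_sum_poly k)
      = smult (int (fib (k + 2))) (monom 1 i * fib_poly k)
        + smult (int (fib (Suc k))) (monom 1 i * fib_poly (Suc k))"
    using arg_cong[OF fib_sum_poly_mult[of k], of "\<lambda>p. monom 1 i * p"]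
    by (simp only: mult.left_commute distrib_left mult_smult_right)
  then show ?thesis
    by (simp only: moment_cseq moment_add moment_smult L_monom_fib_poly)
qed

section \<open>Orthogonal polynomials for the weight x (1 + x)\<close>

text \<open>A division-free form of P_(2m+1) / x, obtained by telescoping x P_(2l) = P_(2l+1) -
  P_(2l-1).\<close>

definition even_sum_poly :: "nat \<Rightarrow> int poly" where
  "even_sum_poly m = (\<Sum>l\<le>m. fib_poly (2 * l))"

lemma pCons_even_sum_poly: "pCons 0 (even_sum_poly m) = fib_poly (Suc (2 * m))"
proof (induction m)
  case 0
  then show ?case by (simp add: even_sum_poly_def pCons_one)
next
  case (Suc m)
  have "pCons 0 (even_sum_poly (Suc m))
      = pCons 0 (even_sum_poly m) + pCons 0 (fib_poly (2 * Suc m))"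
    by (simp add: even_sum_poly_def)
  then show ?case using Suc by simp
qed

lemma degree_even_sum_poly_le: "degree (even_sum_poly m) \<le> 2 * m"
  unfolding even_sum_poly_def
  by (rule degree_sum_le) (auto intro: order.trans[OF degree_fib_poly_le])

lemma coeff_even_sum_poly_self: "coeff (even_sum_poly m) (2 * m) = 1"
  using arg_cong[OF pCons_even_sum_poly[of m], of "\<lambda>p. coeff p (Suc (2 * m))"]
  by (simp only: coeff_pCons_Suc coeff_fib_poly_self)

text \<open>For odd \<open>k\<close>, x (1 + x) p_k contains -F_(k+2) P_(k-1), which would spoil
  orthogonality to x^(k-1). The subtracted multiple of P_k / x removes it.\<close>

definition shifted_poly :: "nat \<Rightarrow> int poly" where
  "shifted_poly k = (if even k then even_sum_poly (k div 2)
     else fib_sum_poly k - smult (int (fib (k + 2))) (even_sum_poly (k div 2)))"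

lemma shifted_poly_even: "shifted_poly (2 * m) = even_sum_poly m"
  by (simp add: shifted_poly_def)

lemma shifted_poly_odd:
  "shifted_poly (Suc (2 * m))
    = fib_sum_poly (Suc (2 * m)) - smult (int (fib (2 * m + 3))) (even_sum_poly m)"
  by (simp add: shifted_poly_def numeral_3_eq_3 del: fib.simps)

lemma degree_shifted_poly_le: "degree (shifted_poly k) \<le> k"
  unfolding shifted_poly_def
  by (auto intro!: degree_diff_le degree_fib_sum_poly_le order.trans[OF degree_smult_le]
      order.trans[OF degree_even_sum_poly_le])

lemma coeff_shifted_poly_even: "coeff (shifted_poly (2 * m)) (2 * m) = 1"
  by (simp add: shifted_poly_even coeff_even_sum_poly_self)

lemma coeff_shifted_poly_odd:
  "coeff (shifted_poly (Suc (2 * m))) (Suc (2 * m)) = int (fib (2 * m + 2))"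
proof -
  have "coeff (even_sum_poly m) (Suc (2 * m)) = 0"
    by (rule coeff_eq_0) (use degree_even_sum_poly_le[of m] in simp)
  then show ?thesis
    by (simp add: shifted_poly_odd coeff_fib_sum_poly_self)
qed

lemma shifted_poly_mult_even:
  "[:1, 1:] * pCons 0 (shifted_poly (2 * m))
    = fib_poly (2 * m + 2) + fib_poly (2 * m + 1) - fib_poly (2 * m)"
  by (simp add: shifted_poly_even pCons_even_sum_poly)

lemma shifted_poly_mult_odd:
  "[:1, 1:] * pCons 0 (shifted_poly (Suc (2 * m)))
    = smult (int (fib (2 * m + 2))) (fib_poly (2 * m + 3))
      - smult (int (fib (2 * m + 4))) (fib_poly (2 * m + 1))"
proof -
  have "[:1, 1:] * pCons 0 (shifted_poly (Suc (2 * m)))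
      = pCons 0 ([:1, 1:] * fib_sum_poly (Suc (2 * m)))
        - smult (int (fib (2 * m + 3))) ([:1, 1:] * pCons 0 (even_sum_poly m))"
    by (simp only: shifted_poly_odd) (simp add: algebra_simps smult_diff_right smult_add_right)
  \<comment> \<open>The two terms F_(2m+3) x P_(2m+1), one from each product, cancel.\<close>
  also have "\<dots> = smult (int (fib (2 * m + 2))) (pCons 0 (fib_poly (2 * m + 2)))
      - smult (int (fib (2 * m + 3))) (fib_poly (2 * m + 1))"
    by (simp only: fib_sum_poly_mult pCons_even_sum_poly)
      (simp add: algebra_simps numeral_3_eq_3 smult_add_left smult_add_right)
  also have "pCons 0 (fib_poly (2 * m + 2)) = fib_poly (2 * m + 3) - fib_poly (2 * m + 1)"
    by (simp add: numeral_3_eq_3)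
  finally have "[:1, 1:] * pCons 0 (shifted_poly (Suc (2 * m)))
      = smult (int (fib (2 * m + 2))) (fib_poly (2 * m + 3) - fib_poly (2 * m + 1))
        - smult (int (fib (2 * m + 3))) (fib_poly (2 * m + 1))" .
  moreover have "int (fib (2 * m + 4)) = int (fib (2 * m + 3)) + int (fib (2 * m + 2))"
    by (simp add: numeral_eq_Suc)
  ultimately show ?thesis
    by (simp only: smult_diff_right smult_add_left diff_diff_eq add.commute)
qed

text \<open>Shifting the index of \<open>cseq\<close> puts a further factor x into the weight 1 +
  x.\<close>

lemma moment_cseq_shift:
  "moment (\<lambda>k. cseq (Suc k)) (monom 1 i * p) = L (monom 1 i * ([:1, 1:] * pCons 0 p))"
proof -
  have "[:1, 1:] * pCons 0 (monom 1 i * p) = monom 1 i * ([:1, 1:] * pCons 0 p)"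
    by (simp add: algebra_simps)
  then show ?thesis
    by (simp only: moment_shift moment_cseq)
qed

lemma cseq_shift_moment_even:
  "moment (\<lambda>k. cseq (Suc k)) (monom 1 i * shifted_poly (2 * m))
    = signed_ballot i (2 * m + 2) + signed_ballot i (2 * m + 1) - signed_ballot i (2 * m)"
  by (simp only: moment_cseq_shift shifted_poly_mult_even distrib_left right_diff_distrib
      moment_add moment_diff L_monom_fib_poly)

lemma cseq_shift_moment_odd:
  "moment (\<lambda>k. cseq (Suc k)) (monom 1 i * shifted_poly (Suc (2 * m)))
    = int (fib (2 * m + 2)) * signed_ballot i (2 * m + 3)
      - int (fib (2 * m + 4)) * signed_ballot i (2 * m + 1)"
  by (simp only: moment_cseq_shift shifted_poly_mult_odd right_diff_distrib mult_smult_right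
      moment_diff moment_smult L_monom_fib_poly)

section \<open>Evaluation of the two determinants\<close>

lemma det_hankel_cseq:
  "det (mat n n (\<lambda>(i, j). cseq (i + j))) = (- 1) ^ (n choose 2) * int (fib (n + 1))"
proof (rule det_hankel_eqI[where p = fib_sum_poly])
  show "coeff (fib_sum_poly k) k \<noteq> 0" for k
    using fib_neq_0_nat[of "Suc k"] by (simp add: coeff_fib_sum_poly_self)
  show "moment cseq (monom 1 i * fib_sum_poly k) = 0" if "i < k" for i k
    using that by (simp add: cseq_moment_fib_sum_poly signed_ballot_eq_0)
  \<comment> \<open>The moment is (-1)^k F_(k+2) and the leading coefficient F_(k+1); the sign fits
    since \<open>Suc k choose 2\<close> exceeds \<open>k choose 2\<close> by
    \<open>k\<close>.\<close>
  show "moment cseq (monom 1 k * fib_sum_poly k) * ((- 1) ^ (k choose 2) * int (fib (k + 1)))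
      = coeff (fib_sum_poly k) k * ((- 1) ^ (Suc k choose 2) * int (fib (Suc k + 1)))" for k
    by (simp add: cseq_moment_fib_sum_poly signed_ballot_eq_0 signed_ballot_same
        coeff_fib_sum_poly_self numeral_2_eq_2 power_add)
qed (simp_all add: degree_fib_sum_poly_le numeral_2_eq_2)

lemma det_hankel_cseq_shift:
  "det (mat n n (\<lambda>(i, j). cseq (Suc (i + j))))
    = (- 1) ^ ((n + 1) choose 2) * int (fib (2 * ((n + 2) div 2)))"
proof (rule det_hankel_eqI[where p = shifted_poly and c = "\<lambda>k. cseq (Suc k)"])
  have parity: "(\<exists>m. k = 2 * m) \<or> (\<exists>m. k = Suc (2 * m))" for k :: nat
    by presburger
  show "coeff (shifted_poly k) k \<noteq> 0" for k
    using parity[of k] fib_neq_0_nat[of "k + 1"]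
    by (auto simp: coeff_shifted_poly_even coeff_shifted_poly_odd)
  show "moment (\<lambda>k. cseq (Suc k)) (monom 1 i * shifted_poly k) = 0" if "i < k" for i k
    using parity[of k] that
    by (auto simp: cseq_shift_moment_even cseq_shift_moment_odd signed_ballot_eq_0)
  \<comment> \<open>For \<open>k = 2 * m\<close> the moment is -1 and the leading coefficient 1, so
    only the sign changes. For \<open>k = 2 * m + 1\<close> they are F_(2m+4) and F_(2m+2), so the
    sign stays and the Fibonacci index grows by 2. This is the source of the floor in the
    formula.\<close>
  show "moment (\<lambda>k. cseq (Suc k)) (monom 1 k * shifted_poly k)
        * ((- 1) ^ ((k + 1) choose 2) * int (fib (2 * ((k + 2) div 2))))
      = coeff (shifted_poly k) k
        * ((- 1) ^ ((Suc k + 1) choose 2) * int (fib (2 * ((Suc k + 2) div 2))))" for k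
  proof -
    have "(- 1 :: int) ^ ((Suc k + 1) choose 2) = (- 1) ^ Suc k * (- 1) ^ ((k + 1) choose 2)"
      by (simp add: numeral_2_eq_2 power_add)
    moreover have "signed_ballot (Suc (2 * m)) (Suc (2 * m)) = - 1" for m
      by (simp add: signed_ballot_same)
    moreover have four: "2 * m + 4 = Suc (Suc (Suc (Suc (2 * m))))" for m :: nat
      by simp
    ultimately show ?thesis
      using parity[of k]
      by (auto simp: cseq_shift_moment_even cseq_shift_moment_odd signed_ballot_eq_0
          signed_ballot_same coeff_shifted_poly_even coeff_shifted_poly_odd four
          simp del: fib.simps binomial_Suc_Suc)
  qed
qed (simp_all add: degree_shifted_poly_le numeral_2_eq_2)

theorem theorem2p1:
  fixes n :: nat
  shows "det (mat n n (\<lambda>(i, j). cseq (i + j))) = (- 1) ^ (n choose 2) * int (fib (n + 1)) \<and>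
    det (mat n n (\<lambda>(i, j). cseq (i + j + 1)))
      = (- 1) ^ ((n + 1) choose 2) * int (fib (2 * ((n + 2) div 2)))"
  using det_hankel_cseq[of n] det_hankel_cseq_shift[of n] by simp

end
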